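(* Let $\mathbb{M}_n$ be a manifold with local coordinates $z^i$ and nondegenerate Poisson tensor $\omega^{ij}$ with bracket $\{A,B\}=\partial_iA\,\omega^{ij}\,\partial_jB$. Suppose the Hamiltonian system $\dot z^i=\omega^{ij}\partial_jH(z)$ admits functionally independent first integrals $\Phi^\alpha(z)$, $\alpha=1,\dots,n-k$, such that $$\{\Phi^\alpha,H\}=0,\qquad \det\triangle^{\alpha\beta}\neq0,\quad \triangle^{\alpha\beta}=\{\Phi^\alpha,\Phi^\beta\}.$$ Let $z^i=(z^\alpha,z^a)$ and let $z^\alpha=f^\alpha(z^a)$ be the solution of $\Phi^\alpha(z)=0$. Then the equations for the independent variables of the dynamics restricted to the invariant surface $\{\Phi^\alpha=0\}$, $$\dot z^a=\left.\omega^{aj}\partial_jH\right|_{z^\alpha=f^\alpha(z^a)},$$ are equivalent to $$\dot z^a=\omega_D^{ab}(f^\alpha(z^c),z^c)\,\frac{\partial}{\partial z^b}H(f^\alpha(z^c),z^c),$$ where $\omega_D^{ab}=\{z^a,z^b\}-\{z^a,\Phi^\alpha\}\,\tilde\triangle_{\alpha\beta}\,\{\Phi^\beta,z^b\}$ and $\tilde\triangle_{\alpha\beta}$ is the inverse matrix of $\triangle^{\alpha\beta}$; and the latter is a Hamiltonian system, i.e. the antisymmetric matrix $\omega_{\mathbf f}^{ab}(z^c)=\omega_D^{ab}(f^\alpha(z^c),z^c)$ satisfies $\omega_{\mathbf f}^{ad}\partial_d\omega_{\mathbf f}^{bc}+\mathrm{cycle}(a,b,c)=0$.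
   Context: All objects are smooth, and all statements are local. Repeated indices are summed; $\mathrm{cycle}$ denotes the two remaining cyclic permutations; the dot is $d/d\tau$. A Poisson tensor is a contravariant tensor $\omega^{ij}(z)$ with $\omega^{ij}=-\omega^{ji}$ and $\omega^{ip}\partial_p\omega^{jk}+\mathrm{cycle}(i,j,k)=0$; it is nondegenerate if $\det\omega\ne0$. Functions $\Phi^\alpha$ are functionally independent if $\operatorname{rank}(\partial_i\Phi^\alpha)=n-k$; coordinates are then grouped as $z^i=(z^\alpha,z^a)$, $a=1,\dots,k$, with $\det(\partial\Phi^\alpha/\partial z^\beta)\ne0$, so that $\Phi^\alpha=0$ can be solved as $z^\alpha=f^\alpha(z^a)$. *)

theory Defs
  imports "HOL-Analysis.Analysis"
begin

(* C^n and C^infinity functions; meaningful on open sets, since the derivatives are taken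
   in the whole space. *)

fun higher_differentiable_on ::
  "'a::real_normed_vector set \<Rightarrow> ('a \<Rightarrow> 'b::real_normed_vector) \<Rightarrow> nat \<Rightarrow> bool" where
  "higher_differentiable_on S f 0 \<longleftrightarrow> continuous_on S f"
| "higher_differentiable_on S f (Suc n) \<longleftrightarrow>
     (\<forall>x\<in>S. f differentiable (at x)) \<and>
     (\<forall>v. higher_differentiable_on S (\<lambda>x. frechet_derivative f (at x) v) n)"

definition smooth_on :: "'a::real_normed_vector set \<Rightarrow> ('a \<Rightarrow> 'b::real_normed_vector) \<Rightarrow> bool" where
  "smooth_on S f \<longleftrightarrow> (\<forall>n. higher_differentiable_on S f n)"

definition pd :: "'n \<Rightarrow> (real^'n \<Rightarrow> real) \<Rightarrow> real^'n::finite \<Rightarrow> real" where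
  "pd i F z = frechet_derivative F (at z) (axis i 1)"

definition poisson_tensor_on :: "(real^'n) set \<Rightarrow> (real^'n \<Rightarrow> real^'n^'n::finite) \<Rightarrow> bool" where
  "poisson_tensor_on U \<omega> \<longleftrightarrow>
     smooth_on U \<omega> \<and>
     (\<forall>z\<in>U. \<forall>i j. \<omega> z $ i $ j = - \<omega> z $ j $ i) \<and>
     (\<forall>z\<in>U. \<forall>i j k.
        (\<Sum>p\<in>UNIV. \<omega> z $ i $ p * pd p (\<lambda>w. \<omega> w $ j $ k) z
                 + \<omega> z $ j $ p * pd p (\<lambda>w. \<omega> w $ k $ i) z
                 + \<omega> z $ k $ p * pd p (\<lambda>w. \<omega> w $ i $ j) z) = 0)"

definition poisson_bracket ::
  "(real^'n \<Rightarrow> real^'n^'n::finite) \<Rightarrow> (real^'n \<Rightarrow> real) \<Rightarrow> (real^'n \<Rightarrow> real) \<Rightarrow> real^'n \<Rightarrow> real" where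
  "poisson_bracket \<omega> A B z = (\<Sum>i\<in>UNIV. \<Sum>j\<in>UNIV. pd i A z * \<omega> z $ i $ j * pd j B z)"

definition hamiltonian_field ::
  "(real^'n \<Rightarrow> real^'n^'n::finite) \<Rightarrow> (real^'n \<Rightarrow> real) \<Rightarrow> real^'n \<Rightarrow> real^'n" where
  "hamiltonian_field \<omega> H z = (\<chi> i. \<Sum>j\<in>UNIV. \<omega> z $ i $ j * pd j H z)"

definition solves_ode_on :: "real set \<Rightarrow> ('a::real_normed_vector \<Rightarrow> 'a) \<Rightarrow> (real \<Rightarrow> 'a) \<Rightarrow> bool" where
  "solves_ode_on T X z \<longleftrightarrow> (\<forall>t\<in>T. (z has_vector_derivative X (z t)) (at t))"

(* Coordinates are indexed by the sum type 'm + 'k: Inl \<alpha> labels z^\<alpha> (CARD('m) = n - k of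
   them) and Inr a labels z^a (CARD('k) = k of them). *)

definition glue :: "real^'m::finite \<Rightarrow> real^'k::finite \<Rightarrow> real^('m + 'k)" where
  "glue x y = (\<chi> i. case i of Inl \<alpha> \<Rightarrow> x $ \<alpha> | Inr a \<Rightarrow> y $ a)"

definition bracket_matrix ::
  "(real^'n \<Rightarrow> real^'n^'n::finite) \<Rightarrow> ('m \<Rightarrow> real^'n \<Rightarrow> real) \<Rightarrow> real^'n \<Rightarrow> real^'m^'m::finite" where
  "bracket_matrix \<omega> \<Phi> z = (\<chi> \<alpha> \<beta>. poisson_bracket \<omega> (\<Phi> \<alpha>) (\<Phi> \<beta>) z)"

definition dirac_tensor ::
  "(real^('m + 'k) \<Rightarrow> real^('m + 'k)^('m + 'k)) \<Rightarrow> ('m \<Rightarrow> real^('m + 'k) \<Rightarrow> real)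
     \<Rightarrow> real^('m::finite + 'k::finite) \<Rightarrow> real^'k^'k" where
  "dirac_tensor \<omega> \<Phi> z = (\<chi> a b.
     poisson_bracket \<omega> (\<lambda>w. w $ Inr a) (\<lambda>w. w $ Inr b) z
     - (\<Sum>\<alpha>\<in>UNIV. \<Sum>\<beta>\<in>UNIV. poisson_bracket \<omega> (\<lambda>w. w $ Inr a) (\<Phi> \<alpha>) z
          * matrix_inv (bracket_matrix \<omega> \<Phi> z) $ \<alpha> $ \<beta>
          * poisson_bracket \<omega> (\<Phi> \<beta>) (\<lambda>w. w $ Inr b) z))"

end

(* On the surface replace each coordinate z^a by F_a = z^a - {z^a, Phi^alpha} Delta~_{alpha beta} Phi^beta.
   At points of the surface {F_a, Phi^gamma} = 0, hence {F_a, F_b} is the Dirac tensor there, and the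
   Hamiltonian vector field of F_a is tangent to the surface. Parametrizing the surface by
   g(x) = (f(x), x), tangency and the chain rule give
     omega_f^{ad} d_d (K o g) = {F_a, K} o g   for every function K.
   For K = {F_b, F_c} this reduces the Jacobi identity of omega_f to that of {F_a, {F_b, F_c}}; for
   K = H it identifies the two reduced vector fields. *)

theory Submission
  imports Defs
begin

text \<open>The Hamiltonian field of a plain coordinate z^a is in general transversal to the
  surface, so its brackets cannot be rewritten as derivatives in the parameters x. Subtracting
  c_beta Phi^beta repairs this when c solves the linear system c_beta {Phi^beta, Phi^gamma} = {z^a,
  Phi^gamma}; the inverse of the bracket matrix in the Dirac tensor is the solution operator of this
  system. The corrected coordinates are built on the open set U and not merely on the surface. Thus
  {F_b, F_c} is again a smooth function on U, the nested bracket {F_a, {F_b, F_c}} makes sense, and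
  the Jacobi identity of the given bracket can be evaluated at surface points. No Jacobi identity
  for a Dirac bracket on all of U has to be established. Two analytic facts carry this: the inverse
  matrix depends smoothly on z, and second partial derivatives commute. Smoothness is defined by
  iterated directional derivatives, so the latter is a theorem here, obtained from second
  differences.\<close>

subsection \<open>Closure properties of smooth functions\<close>

text \<open>Derivatives at a point of an open set see only nearby values, so formulas valid only on
  \<open>S\<close> may replace one another, such as Cramer's formula for an inverse matrix.\<close>

lemma higher_differentiable_on_cong:
  assumes "open S" "\<And>x. x \<in> S \<Longrightarrow> f x = g x" "higher_differentiable_on S f n"
  shows "higher_differentiable_on S g n"
  using assms(2,3)
proof (induction n arbitrary: f g)
  case 0
  then show ?case using continuous_on_cong[of S S f g] by simp
next
  case (Suc n)
  have d: "(g has_derivative frechet_derivative f (at x)) (at x)" if "x \<in> S" for x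
  proof (rule has_derivative_transform_within_open)
    show "(f has_derivative frechet_derivative f (at x)) (at x)"
      using Suc.prems that by (simp add: frechet_derivative_works[symmetric])
  qed (use assms(1) that Suc.prems in auto)
  have e: "frechet_derivative f (at x) = frechet_derivative g (at x)" if "x \<in> S" for x
    using frechet_derivative_at[OF d[OF that]] .
  have "higher_differentiable_on S (\<lambda>x. frechet_derivative g (at x) v) n" for v
    by (rule Suc.IH[of "\<lambda>x. frechet_derivative f (at x) v"]) (use e Suc.prems in auto)
  with d show ?case by (auto simp: differentiable_def)
qed

text \<open>Uniqueness of the derivative allows any explicit formula \<open>D\<close> in place of
  \<open>frechet_derivative\<close>. The closure lemmas below all use this: a differentiation rule
  supplies \<open>D\<close>, and the induction hypothesis handles \<open>D x v\<close> for each
  fixed direction \<open>v\<close>.\<close>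

lemma higher_differentiable_on_SucI:
  assumes "open S" "\<And>x. x \<in> S \<Longrightarrow> (f has_derivative D x) (at x)"
    and "\<And>v. higher_differentiable_on S (\<lambda>x. D x v) n"
  shows "higher_differentiable_on S f (Suc n)"
proof -
  have "D x = frechet_derivative f (at x)" if "x \<in> S" for x
    using frechet_derivative_at[OF assms(2)[OF that]] .
  then have "higher_differentiable_on S (\<lambda>x. frechet_derivative f (at x) v) n" for v
    by (intro higher_differentiable_on_cong[OF assms(1) _ assms(3)[of v]]) simp
  then show ?thesis using assms(2) by (auto simp: differentiable_def)
qed

lemma higher_differentiable_on_has_derivative:
  "higher_differentiable_on S f (Suc n) \<Longrightarrow> x \<in> S \<Longrightarrow>
    (f has_derivative frechet_derivative f (at x)) (at x)"
  by (simp add: frechet_derivative_works[symmetric])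

text \<open>The product, quotient and chain rules leave some factors undifferentiated; these are
  needed at order \<open>n\<close> although the hypothesis gives order \<open>Suc n\<close>.\<close>

lemma higher_differentiable_on_SucD:
  "higher_differentiable_on S f (Suc n) \<Longrightarrow> higher_differentiable_on S f n"
proof (induction n arbitrary: f)
  case 0
  then show ?case
    by (auto intro!: continuous_at_imp_continuous_on differentiable_imp_continuous_within)
next
  case (Suc n)
  then show ?case by (metis higher_differentiable_on.simps(2))
qed

lemma higher_differentiable_on_const:
  "higher_differentiable_on S (\<lambda>x. c) n"
  by (induction n arbitrary: c) auto

lemma higher_differentiable_on_linear:
  assumes "open S" "bounded_linear L" "higher_differentiable_on S f n"
  shows "higher_differentiable_on S (\<lambda>x. L (f x)) n"
  using assms(3)
proof (induction n arbitrary: f)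
  case 0
  then show ?case using bounded_linear.continuous_on[OF assms(2)] by simp
next
  case (Suc n)
  show ?case
    by (rule higher_differentiable_on_SucI[OF assms(1) bounded_linear.has_derivative[OF assms(2)
        higher_differentiable_on_has_derivative[OF Suc.prems]]], assumption, rule Suc.IH)
      (use Suc.prems in auto)
qed

lemma higher_differentiable_on_add:
  assumes "open S" "higher_differentiable_on S f n" "higher_differentiable_on S g n"
  shows "higher_differentiable_on S (\<lambda>x. f x + g x) n"
  using assms(2,3)
proof (induction n arbitrary: f g)
  case 0
  then show ?case by (simp add: continuous_on_add)
next
  case (Suc n)
  show ?case
    by (rule higher_differentiable_on_SucI[OF assms(1) has_derivative_add[OF
        higher_differentiable_on_has_derivative[OF Suc.prems(1)]
        higher_differentiable_on_has_derivative[OF Suc.prems(2)]]], assumption, assumption, rule Suc.IH)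
      (use Suc.prems in auto)
qed

lemma higher_differentiable_on_sum:
  assumes "open S" "\<And>i. i \<in> I \<Longrightarrow> higher_differentiable_on S (f i) n"
  shows "higher_differentiable_on S (\<lambda>x. \<Sum>i\<in>I. f i x) n"
  using assms(2)
  by (induction I rule: infinite_finite_induct)
    (simp_all add: higher_differentiable_on_const higher_differentiable_on_add[OF assms(1)])

lemma higher_differentiable_on_bilinear:
  assumes "open S" "bounded_bilinear B"
    and "higher_differentiable_on S f n" "higher_differentiable_on S g n"
  shows "higher_differentiable_on S (\<lambda>x. B (f x) (g x)) n"
  using assms(3,4)
proof (induction n arbitrary: f g)
  case 0
  then show ?case by (simp add: bounded_bilinear.continuous_on[OF assms(2)])
next
  case (Suc n)
  show ?case
    by (rule higher_differentiable_on_SucI[OF assms(1) bounded_bilinear.FDERIV[OF assms(2)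
        higher_differentiable_on_has_derivative[OF Suc.prems(1)]
        higher_differentiable_on_has_derivative[OF Suc.prems(2)]]],
        assumption, assumption, intro higher_differentiable_on_add[OF assms(1)] Suc.IH)
      (use Suc.prems Suc.prems[THEN higher_differentiable_on_SucD] in auto)
qed

lemma higher_differentiable_on_inverse:
  fixes f :: "'a::real_normed_vector \<Rightarrow> real"
  assumes "open S" "higher_differentiable_on S f n" "\<And>x. x \<in> S \<Longrightarrow> f x \<noteq> 0"
  shows "higher_differentiable_on S (\<lambda>x. inverse (f x)) n"
  using assms(2)
proof (induction n)
  case 0
  then show ?case using assms(3) by (simp add: continuous_on_inverse)
next
  case (Suc n)
  have i: "higher_differentiable_on S (\<lambda>x. inverse (f x)) n"
    using Suc higher_differentiable_on_SucD by blast
  \<comment> \<open>The derivative is written purely as products, with the sign as a constant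
    factor, so that closure under multiplication applies. The factors \<open>inverse (f x)\<close>
    come from the induction hypothesis.\<close>
  have D: "((\<lambda>x. inverse (f x)) has_derivative
      (\<lambda>v. (- 1) * (inverse (f x) * (frechet_derivative f (at x) v * inverse (f x))))) (at x)"
    if "x \<in> S" for x
    using Deriv.has_derivative_inverse[OF assms(3)[OF that]
        higher_differentiable_on_has_derivative[OF Suc.prems that]]
    by (simp add: mult.assoc)
  show ?case
    by (rule higher_differentiable_on_SucI[OF assms(1) D], assumption,
        intro higher_differentiable_on_bilinear[OF assms(1) bounded_bilinear_mult]
          higher_differentiable_on_const i)
      (use Suc.prems in auto)
qed

text \<open>In the chain rule the outer derivative is applied to a direction that varies with
  \<open>x\<close>, whereas higher differentiability controls it only in fixed directions. Expanding
  the direction in \<open>Basis\<close> separates the two dependences; this is why the middle space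
  is Euclidean.\<close>

lemma higher_differentiable_on_compose:
  fixes F :: "'b::euclidean_space \<Rightarrow> 'c::real_normed_vector"
    and g :: "'a::real_normed_vector \<Rightarrow> 'b"
  assumes "open S" "open T" "\<And>x. x \<in> S \<Longrightarrow> g x \<in> T"
    and "higher_differentiable_on T F n" "higher_differentiable_on S g n"
  shows "higher_differentiable_on S (\<lambda>x. F (g x)) n"
  using assms(4,5)
proof (induction n arbitrary: F)
  case 0
  then show ?case using assms(3) by (auto intro: continuous_on_compose2)
next
  case (Suc n)
  let ?DF = "\<lambda>x. frechet_derivative F (at (g x))" and ?Dg = "\<lambda>x. frechet_derivative g (at x)"
  have D: "((\<lambda>x. F (g x)) has_derivative
      (\<lambda>v. \<Sum>b\<in>Basis. (?Dg x v \<bullet> b) *\<^sub>R ?DF x b)) (at x)" if "x \<in> S" for x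
  proof -
    have d: "(F has_derivative ?DF x) (at (g x))"
      by (rule higher_differentiable_on_has_derivative[OF Suc.prems(1) assms(3)[OF that]])
    have "?DF x u = (\<Sum>b\<in>Basis. (u \<bullet> b) *\<^sub>R ?DF x b)" for u
      using linear_sum[OF has_derivative_linear[OF d], of "\<lambda>b. (u \<bullet> b) *\<^sub>R b" Basis]
      by (simp add: euclidean_representation linear_cmul[OF has_derivative_linear[OF d]])
    then show ?thesis
      by (intro has_derivative_eq_rhs[OF has_derivative_compose[OF
          higher_differentiable_on_has_derivative[OF Suc.prems(2) that] d]] ext)
  qed
  have g: "higher_differentiable_on S g n"
    using Suc.prems(2) by (rule higher_differentiable_on_SucD)
  have "higher_differentiable_on S (\<lambda>x. \<Sum>b\<in>Basis. (?Dg x v \<bullet> b) *\<^sub>R ?DF x b) n" (is "?P v") for v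
  proof (intro higher_differentiable_on_sum[OF assms(1)]
      higher_differentiable_on_bilinear[OF assms(1) bounded_bilinear_scaleR])
    fix b :: 'b
    show "higher_differentiable_on S (\<lambda>x. ?Dg x v \<bullet> b) n"
      using Suc.prems(2)
      by (auto intro!: higher_differentiable_on_linear[OF assms(1) bounded_linear_inner_left])
    show "higher_differentiable_on S (\<lambda>x. ?DF x b) n"
      by (rule Suc.IH[of "\<lambda>y. frechet_derivative F (at y) b"]) (use Suc.prems g in auto)
  qed
  then have "\<And>v. ?P v" .
  then show ?case
    by (rule higher_differentiable_on_SucI[OF assms(1) D, rotated])
qed

lemma smooth_on_const: "smooth_on S (\<lambda>x. c)"
  by (simp add: smooth_on_def higher_differentiable_on_const)

lemma smooth_on_linear:
  "open S \<Longrightarrow> bounded_linear L \<Longrightarrow> smooth_on S f \<Longrightarrow> smooth_on S (\<lambda>x. L (f x))"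
  unfolding smooth_on_def by (intro allI higher_differentiable_on_linear[of _ L f]) auto

lemma smooth_on_ident: "open S \<Longrightarrow> smooth_on S (\<lambda>x. x)"
  unfolding smooth_on_def
proof
  fix n assume "open S"
  then show "higher_differentiable_on S (\<lambda>x. x) n"
    by (cases n) (auto simp: higher_differentiable_on_const)
qed

lemma smooth_on_sum:
  "open S \<Longrightarrow> (\<And>i. i \<in> I \<Longrightarrow> smooth_on S (f i)) \<Longrightarrow> smooth_on S (\<lambda>x. \<Sum>i\<in>I. f i x)"
  unfolding smooth_on_def by (intro allI higher_differentiable_on_sum) auto

lemma smooth_on_mult:
  fixes f g :: "'a::real_normed_vector \<Rightarrow> real"
  shows "open S \<Longrightarrow> smooth_on S f \<Longrightarrow> smooth_on S g \<Longrightarrow> smooth_on S (\<lambda>x. f x * g x)"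
  unfolding smooth_on_def
  by (intro allI higher_differentiable_on_bilinear[OF _ bounded_bilinear_mult]) auto

lemma smooth_on_diff:
  assumes "open S" "smooth_on S f" "smooth_on S g"
  shows "smooth_on S (\<lambda>x. f x - g x)"
  using higher_differentiable_on_add[OF assms(1), of f _ "\<lambda>x. - g x"] assms
    smooth_on_linear[OF assms(1) bounded_linear_minus[OF bounded_linear_ident] assms(3)]
  by (simp add: smooth_on_def)

lemma smooth_on_prod:
  fixes f :: "'i \<Rightarrow> 'a::real_normed_vector \<Rightarrow> real"
  assumes "open S" "\<And>i. i \<in> I \<Longrightarrow> smooth_on S (f i)"
  shows "smooth_on S (\<lambda>x. \<Prod>i\<in>I. f i x)"
  using assms(2)
  by (induction I rule: infinite_finite_induct)
    (simp_all add: smooth_on_const smooth_on_mult[OF assms(1)])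

lemma smooth_on_divide:
  fixes f g :: "'a::real_normed_vector \<Rightarrow> real"
  assumes "open S" "smooth_on S f" "smooth_on S g" "\<And>x. x \<in> S \<Longrightarrow> g x \<noteq> 0"
  shows "smooth_on S (\<lambda>x. f x / g x)"
  unfolding divide_inverse using assms
  by (intro smooth_on_mult) (auto simp: smooth_on_def intro: higher_differentiable_on_inverse)

lemma smooth_on_compose:
  fixes F :: "'b::euclidean_space \<Rightarrow> 'c::real_normed_vector"
  shows "open S \<Longrightarrow> open T \<Longrightarrow> (\<And>x. x \<in> S \<Longrightarrow> g x \<in> T) \<Longrightarrow> smooth_on T F \<Longrightarrow> smooth_on S g
    \<Longrightarrow> smooth_on S (\<lambda>x. F (g x))"
  unfolding smooth_on_def by (intro allI higher_differentiable_on_compose[of S T g F]) auto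

lemma smooth_on_cong:
  "open S \<Longrightarrow> (\<And>x. x \<in> S \<Longrightarrow> f x = g x) \<Longrightarrow> smooth_on S f \<Longrightarrow> smooth_on S g"
  unfolding smooth_on_def by (intro allI higher_differentiable_on_cong[of S f g]) auto

section \<open>Smooth vector and matrix functions; smoothness of the inverse matrix\<close>

lemma smooth_on_vec_lambda:
  fixes f :: "'n::finite \<Rightarrow> 'a::real_normed_vector \<Rightarrow> 'b::real_normed_vector"
  assumes "open S" "\<And>i. smooth_on S (f i)"
  shows "smooth_on S (\<lambda>x. \<chi> i. f i x)"
proof -
  \<comment> \<open>Embedding one component preserves the norm, hence the bound 1. A vector is the
    sum of these embeddings of its components, so closure under sums and linear maps
    suffices.\<close>
  have "bounded_linear (axis i :: 'b \<Rightarrow> 'b^'n)" for i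
    by (rule bounded_linear_intro[of _ 1])
      (auto simp: vec_eq_iff axis_def norm_vec_def L2_set_def if_distrib[of norm]
        if_distrib[of "\<lambda>x. x\<^sup>2"] cong: if_cong)
  then have "smooth_on S (\<lambda>x. \<Sum>i\<in>UNIV. axis i (f i x) :: 'b^'n)"
    using assms by (intro smooth_on_sum smooth_on_linear[where L = "axis _"]) auto
  moreover have "(\<Sum>i\<in>UNIV. axis i (f i x)) = (\<chi> i. f i x)" for x
    by (simp add: vec_eq_iff axis_def)
  ultimately show ?thesis by simp
qed

lemma smooth_on_vec_nth:
  "open S \<Longrightarrow> smooth_on S f \<Longrightarrow> smooth_on S (\<lambda>x. f x $ i)"
  by (rule smooth_on_linear[OF _ bounded_linear_vec_nth])

lemma smooth_on_det:
  fixes A :: "'a::real_normed_vector \<Rightarrow> real^'n^'n::finite"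
  assumes "open S" "\<And>i j. smooth_on S (\<lambda>x. A x $ i $ j)"
  shows "smooth_on S (\<lambda>x. det (A x))"
  unfolding det_def
  by (intro smooth_on_sum smooth_on_mult smooth_on_prod smooth_on_const assms)

lemma matrix_inv_mult:
  fixes A :: "real^'n^'n::finite"
  assumes "det A \<noteq> 0"
  shows "A ** matrix_inv A = mat 1" "matrix_inv A ** A = mat 1"
  using assms someI_ex[of "\<lambda>B. A ** B = mat 1 \<and> B ** A = mat 1"]
  by (simp_all add: invertible_det_nz[symmetric] invertible_def matrix_inv_def)

text \<open>Column \<open>j\<close> of the inverse solves the linear system with right-hand side
  \<open>axis j 1\<close>, so Cramer's rule gives its entries. As quotients of determinants they are
  visibly smooth in the entries of \<open>A\<close>.\<close>

lemma matrix_inv_nth: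
  fixes A :: "real^'n^'n::finite"
  assumes "det A \<noteq> 0"
  shows "matrix_inv A $ i $ j = det (\<chi> k l. if l = i then axis j 1 $ k else A $ k $ l) / det A"
proof -
  have "A *v (matrix_inv A *v axis j 1) = axis j 1"
    using matrix_inv_mult[OF assms] by (simp add: matrix_vector_mul_assoc)
  from cramer[OF assms, THEN iffD1, OF this]
  have "(matrix_inv A *v axis j 1) $ i
      = det (\<chi> k l. if l = i then axis j 1 $ k else A $ k $ l) / det A"
    by simp
  then show ?thesis by (simp add: matrix_vector_mult_basis column_def)
qed

lemma smooth_on_matrix_inv:
  fixes A :: "'a::real_normed_vector \<Rightarrow> real^'n^'n::finite"
  assumes "open S" "\<And>i j. smooth_on S (\<lambda>x. A x $ i $ j)" "\<And>x. x \<in> S \<Longrightarrow> det (A x) \<noteq> 0"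
  shows "smooth_on S (\<lambda>x. matrix_inv (A x) $ i $ j)"
proof (rule smooth_on_cong[OF assms(1)])
  show "smooth_on S (\<lambda>x. det (\<chi> k l. if l = i then axis j 1 $ k else A x $ k $ l) / det (A x))"
  proof (intro smooth_on_divide smooth_on_det assms)
    show "smooth_on S (\<lambda>x. (\<chi> k l. if l = i then axis j 1 $ k else A x $ k $ l) $ k $ l)" for k l
      by (cases "l = i") (simp_all add: smooth_on_const assms)
  qed
qed (simp add: matrix_inv_nth assms)

subsection \<open>Symmetry of second derivatives\<close>

text \<open>The second difference of \<open>F\<close> is symmetric in \<open>u\<close> and \<open>v\<close>, so it relates values of both mixed
  derivatives at two points that tend to \<open>z\<close> with \<open>t\<close>.\<close>

lemma second_difference:
  fixes F :: "'a::real_normed_vector \<Rightarrow> real"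
  assumes F: "higher_differentiable_on U F 2" and U: "ball z r \<subseteq> U"
    and t: "0 < t" "t * (norm u + norm v) < r"
  obtains p where "norm (p - z) \<le> t * (norm u + norm v)"
    and "F (z + t *\<^sub>R u + t *\<^sub>R v) - F (z + t *\<^sub>R u) - F (z + t *\<^sub>R v) + F z
      = t * t * frechet_derivative (\<lambda>y. frechet_derivative F (at y) u) (at p) v"
proof -
  let ?D = "\<lambda>y. frechet_derivative F (at y)"
  let ?p = "\<lambda>s q. z + s *\<^sub>R u + q *\<^sub>R v"
  have n: "norm (?p s q - z) \<le> t * (norm u + norm v)" if "0 \<le> s" "s \<le> t" "0 \<le> q" "q \<le> t" for s q
  proof -
    have "norm (?p s q - z) \<le> s * norm u + q * norm v"
      using norm_triangle_ineq[of "s *\<^sub>R u" "q *\<^sub>R v"] that by (simp add: algebra_simps)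
    also have "\<dots> \<le> t * norm u + t * norm v"
      using that by (intro add_mono mult_right_mono) auto
    finally show ?thesis by (simp add: algebra_simps)
  qed
  have inU: "?p s q \<in> U" if "0 \<le> s" "s \<le> t" "0 \<le> q" "q \<le> t" for s q
  proof -
    have "norm (?p s q - z) < r" using n[OF that] t(2) by linarith
    then have "?p s q \<in> ball z r" by (simp only: mem_ball dist_norm norm_minus_commute[of z])
    then show ?thesis using U by blast
  qed
  have DF: "(F has_derivative ?D y) (at y)" if "y \<in> U" for y
    using F that by (auto simp: numeral_2_eq_2 frechet_derivative_works[symmetric])
  have DDF: "((\<lambda>y. ?D y u) has_derivative frechet_derivative (\<lambda>y. ?D y u) (at y)) (at y)"
    if "y \<in> U" for y
    using F that by (auto simp: numeral_2_eq_2 frechet_derivative_works[symmetric])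
  have D1: "((\<lambda>s. F (?p s q)) has_derivative (\<lambda>h. ?D (?p s q) (h *\<^sub>R u))) (at s)"
    if "0 \<le> s" "s \<le> t" "0 \<le> q" "q \<le> t" for s q
    by (rule has_derivative_compose[where f = "\<lambda>s. ?p s q", OF _ DF[OF inU[OF that]]]) (auto intro!: derivative_eq_intros)
  have D2: "((\<lambda>q. ?D (?p s q) u) has_derivative
      (\<lambda>h. frechet_derivative (\<lambda>y. ?D y u) (at (?p s q)) (h *\<^sub>R v))) (at q)"
    if "0 \<le> s" "s \<le> t" "0 \<le> q" "q \<le> t" for s q
    by (rule has_derivative_compose[where f = "\<lambda>q. ?p s q", OF _ DDF[OF inU[OF that]]]) (auto intro!: derivative_eq_intros)
  have cont: "continuous_on {0..t} G" if "\<And>s. 0 \<le> s \<Longrightarrow> s \<le> t \<Longrightarrow> (G has_derivative G' s) (at s)"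
    for G :: "real \<Rightarrow> real" and G'
    by (intro continuous_at_imp_continuous_on ballI has_derivative_continuous[OF that]) auto
  \<comment> \<open>The second difference is the increment of this function over the interval from 0
    to \<open>t\<close>. The mean value theorem in \<open>s\<close> extracts one factor
    \<open>t\<close> and the derivative along \<open>u\<close>; a second application, in
    \<open>q\<close>, extracts the other factor and the derivative along \<open>v\<close>.\<close>
  have D1': "((\<lambda>s. F (?p s t) - F (?p s 0)) has_derivative
      (\<lambda>h. ?D (?p s t) (h *\<^sub>R u) - ?D (?p s 0) (h *\<^sub>R u))) (at s)" if "0 \<le> s" "s \<le> t" for s
    using t that by (intro has_derivative_diff D1) auto
  obtain s where s: "0 < s" "s < t"
    and 1: "(F (?p t t) - F (?p t 0)) - (F (?p 0 t) - F (?p 0 0))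
      = ?D (?p s t) ((t - 0) *\<^sub>R u) - ?D (?p s 0) ((t - 0) *\<^sub>R u)"
    by (rule mvt[OF t(1) cont[OF D1'] D1']) auto
  have D2': "((\<lambda>q. ?D (?p s q) u) has_derivative
      (\<lambda>h. frechet_derivative (\<lambda>y. ?D y u) (at (?p s q)) (h *\<^sub>R v))) (at q)"
    if "0 \<le> q" "q \<le> t" for q
    using s that by (intro D2) auto
  obtain q where q: "0 < q" "q < t"
    and 2: "?D (?p s t) u - ?D (?p s 0) u
      = frechet_derivative (\<lambda>y. ?D y u) (at (?p s q)) ((t - 0) *\<^sub>R v)"
    by (rule mvt[OF t(1) cont[OF D2'] D2']) auto
  have "?D (?p s t) (t *\<^sub>R u) = t * ?D (?p s t) u" "?D (?p s 0) (t *\<^sub>R u) = t * ?D (?p s 0) u"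
    using s t linear_cmul[OF has_derivative_linear[OF DF[OF inU]], of s t t u]
      linear_cmul[OF has_derivative_linear[OF DF[OF inU]], of s 0 t u] by auto
  moreover have "frechet_derivative (\<lambda>y. ?D y u) (at (?p s q)) (t *\<^sub>R v)
      = t * frechet_derivative (\<lambda>y. ?D y u) (at (?p s q)) v"
    using s q linear_cmul[OF has_derivative_linear[OF DDF[OF inU]], of s q t v] by auto
  ultimately have "F (?p t t) - F (?p t 0) - F (?p 0 t) + F (?p 0 0)
      = t * t * frechet_derivative (\<lambda>y. ?D y u) (at (?p s q)) v"
    using 1 2 by (simp add: right_diff_distrib[symmetric] mult.assoc)
  with that[of "?p s q"] n[of s q] s q show thesis by simp
qed

lemma second_derivative_symmetric:
  fixes F :: "'a::real_normed_vector \<Rightarrow> real"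
  assumes "open U" "z \<in> U" and F: "higher_differentiable_on U F 2"
  shows "frechet_derivative (\<lambda>y. frechet_derivative F (at y) u) (at z) v
    = frechet_derivative (\<lambda>y. frechet_derivative F (at y) v) (at z) u"
proof -
  define Q where "Q u v p = frechet_derivative (\<lambda>y. frechet_derivative F (at y) u) (at p) v" for u v p
  obtain r where r: "0 < r" "ball z r \<subseteq> U" using assms openE by blast
  have cont: "isCont (Q u v) z" for u v
    using F assms(1,2) unfolding Q_def by (auto simp: numeral_2_eq_2 continuous_on_eq_continuous_at)
  define c where "c = norm u + norm v"
  \<comment> \<open>The summand 1 in \<open>c + 1\<close> keeps the denominator positive even if
    \<open>u\<close> and \<open>v\<close> both vanish, and gives \<open>t n * c < r\<close>; the
    second factor drives \<open>t n\<close> to 0.\<close>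
  define t where "t n = r / ((c + 1) * (Suc n + 1))" for n
  have c: "0 \<le> c" by (simp add: c_def)
  have t0: "0 < t n" for n unfolding t_def using r c by (intro divide_pos_pos mult_pos_pos) auto
  have tr: "t n * c < r" for n
  proof -
    have "0 < c + (real n + (2 + c * real n))"
      using c by (intro add_nonneg_pos[of c] add_nonneg_pos[of "real n"] add_pos_nonneg) auto
    then have "r * c < r * ((c + 1) * (Suc n + 1))"
      using r c by (intro mult_strict_left_mono) (auto simp: algebra_simps)
    then show ?thesis using c by (simp add: t_def field_simps add_pos_nonneg del: of_nat_Suc)
  qed
  have "\<exists>p q. norm (p - z) \<le> t n * c \<and> norm (q - z) \<le> t n * c \<and> Q u v p = Q v u q" for n
  proof -
    obtain p where p: "norm (p - z) \<le> t n * (norm u + norm v)"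
      "F (z + t n *\<^sub>R u + t n *\<^sub>R v) - F (z + t n *\<^sub>R u) - F (z + t n *\<^sub>R v) + F z
        = t n * t n * Q u v p"
      using second_difference[OF F r(2) t0 tr[unfolded c_def]] unfolding Q_def by blast
    obtain q where q: "norm (q - z) \<le> t n * (norm v + norm u)"
      "F (z + t n *\<^sub>R v + t n *\<^sub>R u) - F (z + t n *\<^sub>R v) - F (z + t n *\<^sub>R u) + F z
        = t n * t n * Q v u q"
      using second_difference[OF F r(2) t0 tr[unfolded c_def add.commute[of "norm u"]]]
      unfolding Q_def by blast
    have "t n * t n * Q u v p = t n * t n * Q v u q"
      using p(2) q(2) by (simp add: algebra_simps)
    then have "Q u v p = Q v u q" using t0[of n] by simp
    then show ?thesis using p(1) q(1) by (auto simp: c_def add.commute)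
  qed
  then obtain p q where pq: "\<And>n. norm (p n - z) \<le> t n * c" "\<And>n. norm (q n - z) \<le> t n * c"
    "\<And>n. Q u v (p n) = Q v u (q n)" by metis
  have "(\<lambda>n. r * c / (c + 1) * inverse (real (Suc n) + 1)) \<longlonglongrightarrow> r * c / (c + 1) * 0"
    by (intro tendsto_mult tendsto_const LIMSEQ_Suc[of "\<lambda>n. inverse (real n + 1)"])
      (use LIMSEQ_inverse_real_of_nat in \<open>simp add: add.commute\<close>)
  then have t: "(\<lambda>n. t n * c) \<longlonglongrightarrow> 0"
    by (simp add: t_def field_simps)
  have pq_lim: "p \<longlonglongrightarrow> z" "q \<longlonglongrightarrow> z"
    by (rule LIM_zero_cancel, rule Lim_null_comparison[OF _ t], simp add: pq(1,2))+
  have "(\<lambda>n. Q u v (p n)) \<longlonglongrightarrow> Q u v z" "(\<lambda>n. Q v u (q n)) \<longlonglongrightarrow> Q v u z"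
    by (rule isCont_tendsto_compose[OF cont], rule pq_lim)+
  then have "Q u v z = Q v u z" unfolding pq(3) by (rule LIMSEQ_unique)
  then show ?thesis by (simp add: Q_def)
qed

subsection \<open>Partial derivatives\<close>

lemma pd_eqI: "(F has_derivative D) (at z) \<Longrightarrow> pd i F z = D (axis i 1)"
  by (simp add: pd_def frechet_derivative_at[symmetric])

lemma smooth_on_has_derivative:
  "smooth_on U F \<Longrightarrow> z \<in> U \<Longrightarrow> (F has_derivative frechet_derivative F (at z)) (at z)"
  unfolding smooth_on_def using higher_differentiable_on_has_derivative by blast

lemma smooth_on_has_derivative_pd:
  assumes "smooth_on U F" "z \<in> U"
  shows "(F has_derivative (\<lambda>u. \<Sum>i\<in>UNIV. pd i F z * u $ i)) (at z)"
proof -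
  note d = smooth_on_has_derivative[OF assms]
  have "frechet_derivative F (at z) u = (\<Sum>i\<in>UNIV. pd i F z * u $ i)" for u
  proof -
    have "u = (\<Sum>i\<in>UNIV. (u $ i) *\<^sub>R axis i 1)"
      using basis_expansion[of u] by (simp add: scalar_mult_eq_scaleR)
    then have "frechet_derivative F (at z) u
        = frechet_derivative F (at z) (\<Sum>i\<in>UNIV. (u $ i) *\<^sub>R axis i 1)" by simp
    also have "\<dots> = (\<Sum>i\<in>UNIV. pd i F z * u $ i)"
      by (simp add: linear_sum[OF has_derivative_linear[OF d]]
          linear_cmul[OF has_derivative_linear[OF d]] pd_def mult.commute)
    finally show ?thesis .
  qed
  then show ?thesis using d by presburger
qed

lemma smooth_on_pd: "smooth_on U F \<Longrightarrow> smooth_on U (pd i F)"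
  unfolding smooth_on_def pd_def using higher_differentiable_on.simps(2) by blast

lemma pd_commute:
  assumes "open U" "smooth_on U F" "z \<in> U"
  shows "pd i (pd j F) z = pd j (pd i F) z"
  using second_derivative_symmetric[OF assms(1,3), of F] assms(2)
  unfolding smooth_on_def pd_def by blast

lemma pd_nth: "pd i (\<lambda>w. w $ j) z = (if i = j then 1 else 0)"
  by (subst pd_eqI[OF bounded_linear_imp_has_derivative[OF bounded_linear_vec_nth]])
    (simp add: axis_def)

lemma pd_diff:
  assumes "smooth_on U F" "smooth_on U G" "z \<in> U"
  shows "pd i (\<lambda>w. F w - G w) z = pd i F z - pd i G z"
  by (subst pd_eqI[OF has_derivative_diff[OF
        smooth_on_has_derivative[OF assms(1,3)] smooth_on_has_derivative[OF assms(2,3)]]])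
    (simp add: pd_def)

lemma pd_mult:
  assumes "smooth_on U F" "smooth_on U G" "z \<in> U"
  shows "pd i (\<lambda>w. F w * G w) z = F z * pd i G z + pd i F z * G z"
  by (subst pd_eqI[OF has_derivative_mult[OF
        smooth_on_has_derivative[OF assms(1,3)] smooth_on_has_derivative[OF assms(2,3)]]])
    (simp add: pd_def)

lemma pd_sum:
  assumes "\<And>a. a \<in> I \<Longrightarrow> smooth_on U (F a)" "z \<in> U"
  shows "pd i (\<lambda>w. \<Sum>a\<in>I. F a w) z = (\<Sum>a\<in>I. pd i (F a) z)"
  by (subst pd_eqI[OF has_derivative_sum[OF smooth_on_has_derivative[OF assms(1) assms(2)]]])
    (simp_all add: pd_def)

lemma pd_compose:
  fixes g :: "real^'k::finite \<Rightarrow> real^'n::finite"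
  assumes "smooth_on U F" "open V" "smooth_on V g" "x \<in> V" "g x \<in> U"
  shows "pd d (\<lambda>x. F (g x)) x = (\<Sum>p\<in>UNIV. pd p F (g x) * pd d (\<lambda>x. g x $ p) x)"
proof -
  note D = smooth_on_has_derivative[OF assms(3,4)]
  have "pd d (\<lambda>x. g x $ p) x = frechet_derivative g (at x) (axis d 1) $ p" for p
    by (rule pd_eqI[OF bounded_linear.has_derivative[OF bounded_linear_vec_nth D]])
  then show ?thesis
    by (subst pd_eqI[OF has_derivative_compose[OF D
          smooth_on_has_derivative_pd[OF assms(1,5)]]]) simp
qed

lemma pd_cong:
  assumes "open V" "x \<in> V" "\<And>y. y \<in> V \<Longrightarrow> F y = G y" "smooth_on V F"
  shows "pd d F x = pd d G x"
  using pd_eqI[OF has_derivative_transform_within_open[OF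
        smooth_on_has_derivative[OF assms(4,2)] assms(1,2,3)]]
  by (simp add: pd_def)

subsection \<open>Poisson brackets\<close>

lemma smooth_on_poisson_bracket:
  assumes "open U" "smooth_on U \<omega>" "smooth_on U F" "smooth_on U G"
  shows "smooth_on U (poisson_bracket \<omega> F G)"
  unfolding poisson_bracket_def[abs_def]
  by (intro smooth_on_sum smooth_on_mult smooth_on_pd smooth_on_vec_nth assms)

lemma poisson_bracket_skew:
  assumes "\<And>i j. \<omega> z $ i $ j = - \<omega> z $ j $ i"
  shows "poisson_bracket \<omega> F G z = - poisson_bracket \<omega> G F z"
proof -
  have "poisson_bracket \<omega> F G z = (\<Sum>j\<in>UNIV. \<Sum>i\<in>UNIV. pd i F z * \<omega> z $ i $ j * pd j G z)"
    unfolding poisson_bracket_def by (rule sum.swap)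
  also have "\<dots> = (\<Sum>j\<in>UNIV. \<Sum>i\<in>UNIV. - (pd j G z * \<omega> z $ j $ i * pd i F z))"
    by (intro sum.cong refl, subst assms) simp
  finally show ?thesis by (simp add: poisson_bracket_def sum_negf)
qed

text \<open>Expanding {A, {B, C}} yields a term \<open>R\<close> with a derivative of the tensor and
  two terms \<open>S\<close> with second derivatives of the functions. Over the cyclic sum the six
  \<open>S\<close> terms cancel in pairs, and the \<open>R\<close> terms add up to the Jacobi
  identity of the tensor contracted with the three differentials.\<close>

lemma poisson_bracket_Jacobi:
  fixes \<omega> :: "real^'n \<Rightarrow> real^'n^'n::finite"
  assumes U: "open U" "z \<in> U" and \<omega>: "poisson_tensor_on U \<omega>"
    and smooth: "smooth_on U F" "smooth_on U G" "smooth_on U K"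
  shows "poisson_bracket \<omega> F (poisson_bracket \<omega> G K) z
    + poisson_bracket \<omega> G (poisson_bracket \<omega> K F) z
    + poisson_bracket \<omega> K (poisson_bracket \<omega> F G) z = 0"
proof -
  \<comment> \<open>\<open>X F\<close> is the vector that represents the derivation {F, _} at
    \<open>z\<close>, and \<open>S A B C\<close> is the Hessian of \<open>B\<close> evaluated on
    \<open>X A\<close> and \<open>X C\<close>. Commuting partial derivatives therefore make
    \<open>S\<close> symmetric in its outer arguments.\<close>
  define X where "X F p = (\<Sum>i\<in>UNIV. pd i F z * \<omega> z $ i $ p)" for F p
  define S where "S A B C = (\<Sum>p\<in>UNIV. \<Sum>j\<in>UNIV. X A p * pd p (pd j B) z * X C j)" for A B C
  define R where "R A B C = (\<Sum>i\<in>UNIV. \<Sum>j\<in>UNIV. \<Sum>k\<in>UNIV. \<Sum>p\<in>UNIV.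
    pd i A z * pd j B z * pd k C z * (\<omega> z $ i $ p * pd p (\<lambda>w. \<omega> w $ j $ k) z))" for A B C
  have smooth_\<omega>: "smooth_on U \<omega>" and skew: "\<And>i j. \<omega> z $ i $ j = - \<omega> z $ j $ i"
    and Jac: "\<And>i j k. (\<Sum>p\<in>UNIV. \<omega> z $ i $ p * pd p (\<lambda>w. \<omega> w $ j $ k) z
                 + \<omega> z $ j $ p * pd p (\<lambda>w. \<omega> w $ k $ i) z
                 + \<omega> z $ k $ p * pd p (\<lambda>w. \<omega> w $ i $ j) z) = 0"
    using \<omega> U(2) unfolding poisson_tensor_on_def by blast+
  have S_sym: "S A B C = S C B A" if "smooth_on U B" for A B C
    unfolding S_def
    by (subst sum.swap, intro sum.cong refl)
      (simp add: pd_commute[OF U(1) that U(2)] mult_ac)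
  have key: "poisson_bracket \<omega> A (poisson_bracket \<omega> B C) z = R A B C - S A B C + S A C B"
    if A: "smooth_on U A" and B: "smooth_on U B" and C: "smooth_on U C" for A B C
  proof -
    note sm = smooth_on_mult[OF U(1)] smooth_on_sum[OF U(1)] smooth_on_pd B C
      smooth_on_vec_nth[OF U(1)] smooth_\<omega>
    \<comment> \<open>Contracting the second index instead of the first costs a sign by skew
      symmetry. This sign makes the two \<open>S\<close> terms in \<open>key\<close> opposite and
      hence able to cancel.\<close>
    have X': "(\<Sum>k\<in>UNIV. \<omega> z $ j $ k * pd k C z) = - X C j" for j C
      unfolding X_def sum_negf[symmetric] by (intro sum.cong refl, subst skew) simp
    have D: "pd p (poisson_bracket \<omega> B C) z
        = (\<Sum>j\<in>UNIV. \<Sum>k\<in>UNIV. pd j B z * pd p (\<lambda>w. \<omega> w $ j $ k) z * pd k C z)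
        - (\<Sum>j\<in>UNIV. pd p (pd j B) z * X C j)
        + (\<Sum>k\<in>UNIV. pd p (pd k C) z * X B k)" for p
    proof -
      have "pd p (poisson_bracket \<omega> B C) z = (\<Sum>j\<in>UNIV. \<Sum>k\<in>UNIV.
          pd p (\<lambda>w. pd j B w * \<omega> w $ j $ k * pd k C w) z)"
        unfolding poisson_bracket_def[abs_def]
        by (simp add: pd_sum[OF _ U(2)] sm)
      also have "\<dots> = (\<Sum>j\<in>UNIV. \<Sum>k\<in>UNIV.
          pd j B z * pd p (\<lambda>w. \<omega> w $ j $ k) z * pd k C z
          + pd p (pd j B) z * (\<omega> z $ j $ k * pd k C z)
          + pd p (pd k C) z * (pd j B z * \<omega> z $ j $ k))"
        by (intro sum.cong refl)
          (simp add: pd_mult[OF _ _ U(2)] sm algebra_simps)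
      also have "\<dots> = (\<Sum>j\<in>UNIV. \<Sum>k\<in>UNIV. pd j B z * pd p (\<lambda>w. \<omega> w $ j $ k) z * pd k C z)
          + (\<Sum>j\<in>UNIV. pd p (pd j B) z * (\<Sum>k\<in>UNIV. \<omega> z $ j $ k * pd k C z))
          + (\<Sum>j\<in>UNIV. \<Sum>k\<in>UNIV. pd p (pd k C) z * (pd j B z * \<omega> z $ j $ k))"
        by (simp add: sum.distrib sum_distrib_left)
      also have "(\<Sum>j\<in>UNIV. \<Sum>k\<in>UNIV. pd p (pd k C) z * (pd j B z * \<omega> z $ j $ k))
          = (\<Sum>k\<in>UNIV. pd p (pd k C) z * X B k)"
        by (subst sum.swap) (simp add: X_def sum_distrib_left)
      finally show ?thesis by (simp add: X' sum_negf)
    qed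
    have "poisson_bracket \<omega> A (poisson_bracket \<omega> B C) z
        = (\<Sum>p\<in>UNIV. X A p * pd p (poisson_bracket \<omega> B C) z)"
      unfolding poisson_bracket_def[of \<omega> A] X_def
      by (subst sum.swap) (simp add: sum_distrib_right)
    also have "\<dots> = (\<Sum>p\<in>UNIV. X A p * (\<Sum>j\<in>UNIV. \<Sum>k\<in>UNIV.
          pd j B z * pd p (\<lambda>w. \<omega> w $ j $ k) z * pd k C z)) - S A B C + S A C B"
      unfolding D S_def
      by (simp add: algebra_simps sum.distrib sum_subtractf sum_distrib_left)
    also have "(\<Sum>p\<in>UNIV. X A p * (\<Sum>j\<in>UNIV. \<Sum>k\<in>UNIV.
          pd j B z * pd p (\<lambda>w. \<omega> w $ j $ k) z * pd k C z))
        = (\<Sum>p\<in>UNIV. \<Sum>i\<in>UNIV. \<Sum>j\<in>UNIV. \<Sum>k\<in>UNIV.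
          pd i A z * pd j B z * pd k C z * (\<omega> z $ i $ p * pd p (\<lambda>w. \<omega> w $ j $ k) z))"
      unfolding X_def sum_distrib_right by (simp add: sum_distrib_left mult_ac)
    also have "\<dots> = R A B C"
      unfolding R_def
      by (rule trans[OF sum.swap], rule sum.cong[OF refl], rule trans[OF sum.swap],
          rule sum.cong[OF refl], rule sum.swap)
    finally show ?thesis .
  qed
  \<comment> \<open>Cyclic reordering of the sums lets \<open>i\<close>, \<open>j\<close>,
    \<open>k\<close> belong to \<open>F\<close>, \<open>G\<close>, \<open>K\<close> in all three
    \<open>R\<close> terms, so that the products of first derivatives can be factored out.\<close>
  have rot: "(\<Sum>i\<in>UNIV. \<Sum>j\<in>UNIV. \<Sum>k\<in>UNIV. h i j k) = (\<Sum>k\<in>UNIV. \<Sum>i\<in>UNIV. \<Sum>j\<in>UNIV. h i j k)"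
    for h :: "'n \<Rightarrow> 'n \<Rightarrow> 'n \<Rightarrow> real"
    by (rule trans[OF _ sum.swap], rule sum.cong[OF refl], rule sum.swap)
  have "R F G K + R G K F + R K F G = (\<Sum>i\<in>UNIV. \<Sum>j\<in>UNIV. \<Sum>k\<in>UNIV.
      pd i F z * pd j G z * pd k K z * (\<Sum>p\<in>UNIV. \<omega> z $ i $ p * pd p (\<lambda>w. \<omega> w $ j $ k) z
                 + \<omega> z $ j $ p * pd p (\<lambda>w. \<omega> w $ k $ i) z
                 + \<omega> z $ k $ p * pd p (\<lambda>w. \<omega> w $ i $ j) z))"
  proof -
    have "R G K F = (\<Sum>i\<in>UNIV. \<Sum>j\<in>UNIV. \<Sum>k\<in>UNIV. \<Sum>p\<in>UNIV.
        pd j G z * pd k K z * pd i F z * (\<omega> z $ j $ p * pd p (\<lambda>w. \<omega> w $ k $ i) z))"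
      unfolding R_def by (rule rot)
    moreover have "R K F G = (\<Sum>i\<in>UNIV. \<Sum>j\<in>UNIV. \<Sum>k\<in>UNIV. \<Sum>p\<in>UNIV.
        pd k K z * pd i F z * pd j G z * (\<omega> z $ k $ p * pd p (\<lambda>w. \<omega> w $ i $ j) z))"
      unfolding R_def by (rule rot[symmetric])
    ultimately show ?thesis
      unfolding R_def by (simp add: sum.distrib sum_distrib_left algebra_simps)
  qed
  also have "\<dots> = 0" by (simp add: Jac)
  finally have "R F G K + R G K F + R K F G = 0" .
  then show ?thesis
    using S_sym[OF smooth(1), of G K] S_sym[OF smooth(2), of K F] S_sym[OF smooth(3), of F G]
    by (simp add: key smooth)
qed

subsection \<open>The reduced tensor\<close>

text \<open>A bracket sees its first argument only through the differential at \<open>z\<close>. A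
  linear relation between differentials at this single point is therefore enough, with
  \<open>c\<close> a family of numbers.\<close>

lemma poisson_bracket_combination:
  assumes "\<And>i. pd i F z = pd i F0 z - (\<Sum>\<beta>\<in>UNIV. c \<beta> * pd i (\<Phi> \<beta>) z)"
  shows "poisson_bracket \<omega> F K z
    = poisson_bracket \<omega> F0 K z - (\<Sum>\<beta>\<in>(UNIV :: 'm::finite set). c \<beta> * poisson_bracket \<omega> (\<Phi> \<beta>) K z)"
proof -
  have "(\<Sum>\<beta>\<in>(UNIV :: 'm set). c \<beta> * poisson_bracket \<omega> (\<Phi> \<beta>) K z)
      = (\<Sum>i\<in>UNIV. \<Sum>\<beta>\<in>UNIV. \<Sum>j\<in>UNIV. c \<beta> * (pd i (\<Phi> \<beta>) z * \<omega> z $ i $ j * pd j K z))"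
    unfolding poisson_bracket_def sum_distrib_left by (rule sum.swap)
  also have "\<dots> = (\<Sum>i\<in>UNIV. \<Sum>j\<in>UNIV. (\<Sum>\<beta>\<in>UNIV. c \<beta> * pd i (\<Phi> \<beta>) z) * \<omega> z $ i $ j * pd j K z)"
    unfolding sum_distrib_right by (intro sum.cong[OF refl] trans[OF sum.swap]) (simp add: mult_ac)
  finally show ?thesis
    unfolding poisson_bracket_def assms
    by (simp add: left_diff_distrib sum_subtractf)
qed

lemma poisson_bracket_field:
  "poisson_bracket \<omega> F K z = (\<Sum>p\<in>UNIV. (\<Sum>i\<in>UNIV. pd i F z * \<omega> z $ i $ p) * pd p K z)"
  unfolding poisson_bracket_def by (subst sum.swap) (simp add: sum_distrib_right)

lemma poisson_bracket_hamiltonian_field: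
  "poisson_bracket \<omega> F K z = (\<Sum>i\<in>UNIV. pd i F z * hamiltonian_field \<omega> K z $ i)"
  unfolding poisson_bracket_def hamiltonian_field_def by (simp add: sum_distrib_left mult.assoc)

lemma sum_delta_mult:
  fixes h :: "'n::finite \<Rightarrow> real"
  shows "(\<Sum>i\<in>UNIV. (if i = k then 1 else 0) * h i) = h k"
    and "(\<Sum>i\<in>UNIV. h i * (if i = k then 1 else 0)) = h k"
  by (simp_all add: if_distrib[of "\<lambda>x. x * _"] if_distrib[of "times _"] cong: if_cong)

lemma poisson_bracket_nth:
  "poisson_bracket \<omega> (\<lambda>w. w $ i) K z = hamiltonian_field \<omega> K z $ i"
  by (simp add: poisson_bracket_hamiltonian_field pd_nth sum_delta_mult)

section \<open>The parametrized constraint surface and its tangent vectors\<close>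

locale constraint_surface =
  fixes U :: "(real^('m::finite + 'k::finite)) set"
    and \<omega> :: "real^('m + 'k) \<Rightarrow> real^('m + 'k)^('m + 'k)"
    and \<Phi> :: "'m \<Rightarrow> real^('m + 'k) \<Rightarrow> real"
    and V :: "(real^'k) set"
    and f :: "real^'k \<Rightarrow> real^'m"
  assumes U: "open U"
    and \<omega>: "poisson_tensor_on U \<omega>"
    and \<Phi>: "smooth_on U (\<Phi> \<alpha>)"
    and det_\<Phi>: "z \<in> U \<Longrightarrow> det ((\<chi> \<alpha> \<beta>. pd (Inl \<beta>) (\<Phi> \<alpha>) z) :: real^'m^'m) \<noteq> 0"
    and det_bracket: "z \<in> U \<Longrightarrow> det (bracket_matrix \<omega> \<Phi> z) \<noteq> 0"
    and V: "open V"
    and f: "smooth_on V f"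
    and surface: "{z\<in>U. \<forall>\<alpha>. \<Phi> \<alpha> z = 0} = (\<lambda>y. glue (f y) y) ` V"
begin

definition g :: "real^'k \<Rightarrow> real^('m + 'k)" where "g x = glue (f x) x"

lemma g_Inr [simp]: "g x $ Inr a = x $ a"
  by (simp add: g_def glue_def)

lemma g_in: "x \<in> V \<Longrightarrow> g x \<in> U" and \<Phi>_g: "x \<in> V \<Longrightarrow> \<Phi> \<alpha> (g x) = 0"
  using surface unfolding g_def by blast+

lemma smooth_g: "smooth_on V g"
proof -
  have "smooth_on V (\<lambda>x. case i of Inl \<alpha> \<Rightarrow> f x $ \<alpha> | Inr a \<Rightarrow> x $ a)" for i :: "'m + 'k"
    using V f by (cases i) (auto intro: smooth_on_vec_nth smooth_on_ident)
  then show ?thesis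
    unfolding g_def[abs_def] glue_def by (rule smooth_on_vec_lambda[OF V])
qed

lemma pd_compose_g:
  "smooth_on U F \<Longrightarrow> x \<in> V \<Longrightarrow>
    pd d (\<lambda>x. F (g x)) x = (\<Sum>p\<in>UNIV. pd p F (g x) * pd d (\<lambda>x. g x $ p) x)"
  by (rule pd_compose[OF _ V smooth_g _ g_in])

lemma \<omega>_skew: "z \<in> U \<Longrightarrow> \<omega> z $ i $ j = - \<omega> z $ j $ i"
  using \<omega> unfolding poisson_tensor_on_def by blast

text \<open>Since the constraints vanish along \<open>g\<close>, their differentials annihilate the
  partial derivatives of \<open>g\<close>. Subtracting from \<open>v\<close> the combination of
  these with coefficients \<open>v (Inr d)\<close> leaves a vector \<open>u\<close> without
  \<open>Inr\<close> components that is still annihilated. Its \<open>Inl\<close> part lies in the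
  kernel of the invertible Jacobian block \<open>A\<close>, so \<open>u\<close> is zero.\<close>

lemma tangent_vector:
  assumes x: "x \<in> V" and v: "\<And>\<alpha>. (\<Sum>p\<in>UNIV. pd p (\<Phi> \<alpha>) (g x) * v p) = 0"
  shows "v p = (\<Sum>d\<in>UNIV. v (Inr d) * pd d (\<lambda>x. g x $ p) x)"
proof -
  define u where "u p = v p - (\<Sum>d\<in>UNIV. v (Inr d) * pd d (\<lambda>x. g x $ p) x)" for p
  define A :: "real^'m^'m" where "A = (\<chi> \<alpha> \<beta>. pd (Inl \<beta>) (\<Phi> \<alpha>) (g x))"
  have "pd d (\<lambda>x. \<Phi> \<alpha> (g x)) x = pd d (\<lambda>x. 0 :: real) x" for d \<alpha>
    by (rule pd_cong[OF V x]) (auto simp: \<Phi>_g intro: smooth_on_compose[OF V U g_in \<Phi> smooth_g])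
  then have t: "(\<Sum>p\<in>UNIV. pd p (\<Phi> \<alpha>) (g x) * pd d (\<lambda>x. g x $ p) x) = 0" for d \<alpha>
    using pd_compose_g[OF \<Phi> x] by (simp add: pd_def[of _ "\<lambda>x. 0"])
  have u_Inr: "u (Inr a) = 0" for a
    by (simp add: u_def pd_nth sum_delta_mult)
  have "(\<Sum>p\<in>UNIV. pd p (\<Phi> \<alpha>) (g x) * u p) = 0" for \<alpha>
  proof -
    have "(\<Sum>p\<in>UNIV. pd p (\<Phi> \<alpha>) (g x) * (\<Sum>d\<in>UNIV. v (Inr d) * pd d (\<lambda>x. g x $ p) x))
        = (\<Sum>d\<in>UNIV. v (Inr d) * (\<Sum>p\<in>UNIV. pd p (\<Phi> \<alpha>) (g x) * pd d (\<lambda>x. g x $ p) x))"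
      unfolding sum_distrib_left by (subst sum.swap) (simp add: mult_ac)
    then show ?thesis
      using v by (simp add: u_def right_diff_distrib sum_subtractf t)
  qed
  moreover have "(\<Sum>p\<in>UNIV. h p) = (\<Sum>\<beta>\<in>UNIV. h (Inl \<beta>)) + (\<Sum>a\<in>UNIV. h (Inr a))"
    for h :: "'m + 'k \<Rightarrow> real"
    unfolding UNIV_Plus_UNIV[symmetric] by (simp add: sum.Plus del: UNIV_Plus_UNIV)
  ultimately have "(\<Sum>\<beta>\<in>UNIV. pd (Inl \<beta>) (\<Phi> \<alpha>) (g x) * u (Inl \<beta>)) = 0" for \<alpha>
    by (simp add: u_Inr)
  then have Au: "A *v (\<chi> \<beta>. u (Inl \<beta>)) = 0"
    by (simp add: vec_eq_iff matrix_vector_mult_def A_def)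
  have "(\<chi> \<beta>. u (Inl \<beta>)) = (matrix_inv A ** A) *v (\<chi> \<beta>. u (Inl \<beta>))"
    unfolding A_def by (simp add: matrix_inv_mult det_\<Phi> g_in x)
  also have "\<dots> = 0"
    unfolding matrix_vector_mul_assoc[symmetric] Au by simp
  finally have "u (Inl \<beta>) = 0" for \<beta>
    by (simp add: vec_eq_iff)
  with u_Inr have "u p = 0" by (cases p) auto
  then show ?thesis by (simp add: u_def)
qed

text \<open>These are the multipliers c_beta with c_beta {Phi^beta, Phi^gamma} = {z^a, Phi^gamma},
  taken as functions of \<open>z\<close> on all of \<open>U\<close>.\<close>

definition coeff :: "'k \<Rightarrow> 'm \<Rightarrow> real^('m + 'k) \<Rightarrow> real" where
  "coeff a \<beta> z = (\<Sum>\<alpha>\<in>UNIV. poisson_bracket \<omega> (\<lambda>w. w $ Inr a) (\<Phi> \<alpha>) z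
    * matrix_inv (bracket_matrix \<omega> \<Phi> z) $ \<alpha> $ \<beta>)"

definition corrected :: "'k \<Rightarrow> real^('m + 'k) \<Rightarrow> real" where
  "corrected a z = z $ Inr a - (\<Sum>\<beta>\<in>UNIV. coeff a \<beta> z * \<Phi> \<beta> z)"

lemma smooth_nth: "smooth_on U (\<lambda>w. w $ i)"
  by (intro smooth_on_vec_nth smooth_on_ident U)

lemma smooth_bracket:
  "smooth_on U F \<Longrightarrow> smooth_on U G \<Longrightarrow> smooth_on U (poisson_bracket \<omega> F G)"
  using \<omega>[unfolded poisson_tensor_on_def, THEN conjunct1] by (rule smooth_on_poisson_bracket[OF U])

lemma smooth_coeff: "smooth_on U (coeff a \<beta>)"
  unfolding coeff_def[abs_def]
proof (intro smooth_on_sum[OF U] smooth_on_mult[OF U] smooth_on_matrix_inv[OF U])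
  show "smooth_on U (\<lambda>z. bracket_matrix \<omega> \<Phi> z $ i $ j)" for i j
    by (simp add: bracket_matrix_def smooth_bracket \<Phi>)
qed (use det_bracket in \<open>auto intro: smooth_bracket \<Phi> smooth_nth\<close>)

lemma smooth_corrected: "smooth_on U (corrected a)"
  unfolding corrected_def[abs_def]
  by (intro smooth_on_diff smooth_on_sum smooth_on_mult U smooth_nth smooth_coeff \<Phi>)

text \<open>The product rule also produces derivatives of \<open>coeff\<close>, but each is
  multiplied by a constraint, which vanishes at \<open>g x\<close>. On the surface the multipliers
  thus behave like constants.\<close>

lemma pd_corrected:
  assumes "x \<in> V"
  shows "pd i (corrected a) (g x)
    = pd i (\<lambda>w. w $ Inr a) (g x) - (\<Sum>\<beta>\<in>UNIV. coeff a \<beta> (g x) * pd i (\<Phi> \<beta>) (g x))"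
proof -
  note sm = smooth_nth smooth_on_sum[OF U] smooth_on_mult[OF U] smooth_coeff \<Phi>
  show ?thesis
    unfolding corrected_def[abs_def] using assms
    by (simp add: pd_diff[OF _ _ g_in] pd_sum[OF _ g_in] pd_mult[OF _ _ g_in] sm \<Phi>_g)
qed

lemmas bracket_corrected = poisson_bracket_combination[OF pd_corrected]

lemma bracket_corrected_constraint:
  assumes "x \<in> V"
  shows "poisson_bracket \<omega> (corrected a) (\<Phi> \<gamma>) (g x) = 0"
proof -
  let ?B = "bracket_matrix \<omega> \<Phi> (g x)"
  have "(\<Sum>\<beta>\<in>UNIV. coeff a \<beta> (g x) * poisson_bracket \<omega> (\<Phi> \<beta>) (\<Phi> \<gamma>) (g x))
      = (\<Sum>\<alpha>\<in>UNIV. poisson_bracket \<omega> (\<lambda>w. w $ Inr a) (\<Phi> \<alpha>) (g x)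
          * (\<Sum>\<beta>\<in>UNIV. matrix_inv ?B $ \<alpha> $ \<beta> * ?B $ \<beta> $ \<gamma>))"
    unfolding coeff_def sum_distrib_right sum_distrib_left
    by (subst sum.swap) (simp add: bracket_matrix_def mult_ac)
  also have "\<dots> = (\<Sum>\<alpha>\<in>UNIV. poisson_bracket \<omega> (\<lambda>w. w $ Inr a) (\<Phi> \<alpha>) (g x)
      * (matrix_inv ?B ** ?B) $ \<alpha> $ \<gamma>)"
    by (simp add: matrix_matrix_mult_def)
  also have "\<dots> = poisson_bracket \<omega> (\<lambda>w. w $ Inr a) (\<Phi> \<gamma>) (g x)"
    by (simp add: matrix_inv_mult det_bracket g_in assms mat_def sum_delta_mult)
  finally show ?thesis by (simp add: bracket_corrected assms)
qed

lemma bracket_corrected_nth: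
  assumes "x \<in> V"
  shows "poisson_bracket \<omega> (corrected a) (\<lambda>w. w $ Inr b) (g x) = dirac_tensor \<omega> \<Phi> (g x) $ a $ b"
proof -
  have "(\<Sum>\<beta>\<in>UNIV. coeff a \<beta> (g x) * poisson_bracket \<omega> (\<Phi> \<beta>) (\<lambda>w. w $ Inr b) (g x))
    = (\<Sum>\<alpha>\<in>UNIV. \<Sum>\<beta>\<in>UNIV. poisson_bracket \<omega> (\<lambda>w. w $ Inr a) (\<Phi> \<alpha>) (g x)
          * matrix_inv (bracket_matrix \<omega> \<Phi> (g x)) $ \<alpha> $ \<beta>
          * poisson_bracket \<omega> (\<Phi> \<beta>) (\<lambda>w. w $ Inr b) (g x))"
    unfolding coeff_def sum_distrib_right by (rule sum.swap)
  then show ?thesis by (simp add: bracket_corrected assms dirac_tensor_def)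
qed

text \<open>\<open>bracket_corrected\<close> expands only the first argument, so skew symmetry moves
  \<open>corrected b\<close> there. Its correction contributes brackets of constraints with
  \<open>corrected a\<close>, all zero on the surface; what remains is the bracket of
  \<open>corrected a\<close> with z^b.\<close>

lemma bracket_corrected_corrected:
  assumes "x \<in> V"
  shows "poisson_bracket \<omega> (corrected a) (corrected b) (g x) = dirac_tensor \<omega> \<Phi> (g x) $ a $ b"
proof -
  note skew = poisson_bracket_skew[where \<omega> = \<omega> and z = "g x", OF \<omega>_skew[OF g_in[OF assms]]]
  have "poisson_bracket \<omega> (corrected b) (corrected a) (g x)
      = poisson_bracket \<omega> (\<lambda>w. w $ Inr b) (corrected a) (g x)"
    by (simp add: bracket_corrected[OF assms, where a = b] skew[of "\<Phi> _"]
        bracket_corrected_constraint assms)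
  then show ?thesis
    using bracket_corrected_nth[OF assms, of a b] skew[of "corrected a" "corrected b"]
      skew[of "corrected a" "\<lambda>w. w $ Inr b"] by simp
qed

lemma dirac_derivative:
  assumes x: "x \<in> V" and F: "smooth_on U F"
  shows "(\<Sum>d\<in>UNIV. dirac_tensor \<omega> \<Phi> (g x) $ a $ d * pd d (\<lambda>x. F (g x)) x)
    = poisson_bracket \<omega> (corrected a) F (g x)"
proof -
  define v where "v p = (\<Sum>i\<in>UNIV. pd i (corrected a) (g x) * \<omega> (g x) $ i $ p)" for p
  have v: "poisson_bracket \<omega> (corrected a) K (g x) = (\<Sum>p\<in>UNIV. pd p K (g x) * v p)" for K
    by (simp add: poisson_bracket_field v_def mult.commute)
  \<comment> \<open>Testing the derivation \<open>v\<close> on the coordinate z^d reads off its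
    component. By tangency these components, a row of the Dirac tensor, determine all of
    \<open>v\<close>.\<close>
  have vI: "v (Inr d) = dirac_tensor \<omega> \<Phi> (g x) $ a $ d" for d
    using bracket_corrected_nth[OF x, of a d] by (simp add: v pd_nth sum_delta_mult)
  have v_tangent: "v = (\<lambda>p. \<Sum>d\<in>UNIV. v (Inr d) * pd d (\<lambda>x. g x $ p) x)"
    by (rule ext, rule tangent_vector[OF x])
      (simp add: v[symmetric] bracket_corrected_constraint x)
  have "poisson_bracket \<omega> (corrected a) F (g x) = (\<Sum>p\<in>UNIV. pd p F (g x) *
      (\<Sum>d\<in>UNIV. v (Inr d) * pd d (\<lambda>x. g x $ p) x))"
    unfolding v by (subst (1) v_tangent) (rule refl)
  also have "\<dots> = (\<Sum>d\<in>UNIV. v (Inr d) * pd d (\<lambda>x. F (g x)) x)"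
    unfolding pd_compose_g[OF F x] sum_distrib_left by (subst sum.swap) (simp add: mult_ac)
  finally show ?thesis by (simp add: vI)
qed

lemma dirac_poisson: "poisson_tensor_on V (\<lambda>x. dirac_tensor \<omega> \<Phi> (g x))"
proof -
  let ?w = "\<lambda>x. dirac_tensor \<omega> \<Phi> (g x)" and ?B = "\<lambda>a b. poisson_bracket \<omega> (corrected a) (corrected b)"
  have sB: "smooth_on U (?B a b)" for a b
    by (intro smooth_bracket smooth_corrected)
  have sBg: "smooth_on V (\<lambda>x. ?B a b (g x))" for a b
    by (rule smooth_on_compose[OF V U g_in sB smooth_g])
  \<comment> \<open>The brackets of corrected coordinates agree with the Dirac tensor along
    \<open>g\<close> only, but this is agreement on the whole open set \<open>V\<close>. So both
    smoothness and the derivatives in \<open>x\<close> carry over.\<close>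
  have "smooth_on V (\<lambda>x. \<chi> a b. ?B a b (g x))"
    by (intro smooth_on_vec_lambda V sBg)
  then have "smooth_on V ?w"
    by (rule smooth_on_cong[OF V, rotated]) (simp add: bracket_corrected_corrected vec_eq_iff)
  moreover have "?w x $ a $ b = - ?w x $ b $ a" if "x \<in> V" for x a b
    unfolding bracket_corrected_corrected[OF that, symmetric]
    by (rule poisson_bracket_skew[where \<omega> = \<omega>], rule \<omega>_skew[OF g_in[OF that]])
  moreover have "(\<Sum>p\<in>UNIV. ?w x $ a $ p * pd p (\<lambda>w. ?w w $ b $ c) x
                 + ?w x $ b $ p * pd p (\<lambda>w. ?w w $ c $ a) x
                 + ?w x $ c $ p * pd p (\<lambda>w. ?w w $ a $ b) x) = 0" if x: "x \<in> V" for x a b c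
  proof -
    have "pd p (\<lambda>w. ?w w $ b $ c) x = pd p (\<lambda>x. ?B b c (g x)) x" for p b c
      by (rule pd_cong[OF V x, symmetric]) (simp_all add: bracket_corrected_corrected sBg)
    then have "(\<Sum>p\<in>UNIV. ?w x $ a $ p * pd p (\<lambda>w. ?w w $ b $ c) x)
        = poisson_bracket \<omega> (corrected a) (?B b c) (g x)" for a b c
      by (simp add: dirac_derivative[OF x sB])
    then show ?thesis
      using poisson_bracket_Jacobi[OF U g_in[OF x] \<omega> smooth_corrected smooth_corrected smooth_corrected]
      by (simp add: sum.distrib)
  qed
  ultimately show ?thesis unfolding poisson_tensor_on_def by blast
qed

section \<open>Restriction of the Hamiltonian dynamics to the surface\<close>

context
  fixes H :: "real^('m + 'k) \<Rightarrow> real"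
  assumes H: "smooth_on U H"
    and integral: "z \<in> U \<Longrightarrow> poisson_bracket \<omega> (\<Phi> \<alpha>) H z = 0"
begin

text \<open>The brackets of \<open>corrected a\<close> and of z^a with \<open>H\<close> differ at
  \<open>g x\<close> by a combination of {Phi^beta, H}, which vanishes because the constraints are
  first integrals.\<close>

lemma reduced_field:
  assumes "x \<in> V"
  shows "(\<chi> a. hamiltonian_field \<omega> H (g x) $ Inr a)
    = hamiltonian_field (\<lambda>x. dirac_tensor \<omega> \<Phi> (g x)) (\<lambda>x. H (g x)) x"
  using assms dirac_derivative[OF assms H]
  by (simp add: vec_eq_iff hamiltonian_field_def[of "\<lambda>x. dirac_tensor \<omega> \<Phi> (g x)"]
      bracket_corrected integral g_in poisson_bracket_nth)

text \<open>The condition {Phi^alpha, H} = 0 says that the differentials of the constraints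
  annihilate the Hamiltonian field, so \<open>tangent_vector\<close> recovers the field from its
  \<open>Inr\<close> components. This is the infinitesimal invariance of the surface.\<close>

lemma field_tangent:
  assumes "x \<in> V"
  shows "frechet_derivative g (at x) (\<chi> a. hamiltonian_field \<omega> H (g x) $ Inr a)
    = hamiltonian_field \<omega> H (g x)"
proof -
  let ?X = "hamiltonian_field \<omega> H (g x)"
  have "frechet_derivative g (at x) y $ p = (\<Sum>d\<in>UNIV. pd d (\<lambda>x. g x $ p) x * y $ d)" for y p
    by (rule fun_cong[OF has_derivative_unique[OF
            bounded_linear.has_derivative[OF bounded_linear_vec_nth
              smooth_on_has_derivative[OF smooth_g assms]]
            smooth_on_has_derivative_pd[OF smooth_on_vec_nth[OF V smooth_g] assms]]])
  then have "frechet_derivative g (at x) (\<chi> a. ?X $ Inr a) $ p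
      = (\<Sum>d\<in>UNIV. ?X $ Inr d * pd d (\<lambda>x. g x $ p) x)" for p
    by (simp add: mult.commute)
  also have "\<dots> p = ?X $ p" for p
    by (rule tangent_vector[OF assms, of "\<lambda>p. ?X $ p", symmetric])
      (simp add: poisson_bracket_hamiltonian_field[symmetric] integral g_in assms)
  finally show ?thesis by (simp add: vec_eq_iff)
qed

text \<open>This justifies calling the equations for z^a the restricted dynamics: the dependent
  coordinates f(z^a) satisfy their own equations automatically. Projecting to the \<open>Inr\<close>
  coordinates, a linear left inverse of \<open>g\<close>, gives one direction; the chain rule with
  \<open>field_tangent\<close> gives the other.\<close>

lemma lifted_solution_iff:
  assumes "y ` T \<subseteq> V"
  shows "solves_ode_on T (hamiltonian_field \<omega> H) (\<lambda>t. g (y t)) \<longleftrightarrow>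
    solves_ode_on T (\<lambda>x. \<chi> a. hamiltonian_field \<omega> H (g x) $ Inr a) y"
proof -
  let ?X = "hamiltonian_field \<omega> H"
  have "((\<lambda>t. g (y t)) has_vector_derivative ?X (g (y t))) (at t) \<longleftrightarrow>
    (y has_vector_derivative (\<chi> a. ?X (g (y t)) $ Inr a)) (at t)" if "t \<in> T" for t
  proof
    have \<pi>: "bounded_linear (\<lambda>z::real^('m + 'k). \<chi> a. z $ Inr a :: real^'k)"
      by (intro linear_conv_bounded_linear[THEN iffD1] linearI) (auto simp: vec_eq_iff)
    assume "((\<lambda>t. g (y t)) has_vector_derivative ?X (g (y t))) (at t)"
    from bounded_linear.has_vector_derivative[OF \<pi> this]
    show "(y has_vector_derivative (\<chi> a. ?X (g (y t)) $ Inr a)) (at t)"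
      by simp
  next
    have yV: "y t \<in> V" using assms that by blast
    note D = smooth_on_has_derivative[OF smooth_g yV]
    assume "(y has_vector_derivative (\<chi> a. ?X (g (y t)) $ Inr a)) (at t)"
    from has_derivative_compose[OF this[unfolded has_vector_derivative_def] D]
    show "((\<lambda>t. g (y t)) has_vector_derivative ?X (g (y t))) (at t)"
      by (simp add: has_vector_derivative_def linear_cmul[OF has_derivative_linear[OF D]]
          field_tangent[OF yV])
  qed
  then show ?thesis by (simp add: solves_ode_on_def)
qed

lemma reduced_solution_iff:
  assumes "y ` T \<subseteq> V"
  shows "solves_ode_on T (\<lambda>x. \<chi> a. hamiltonian_field \<omega> H (g x) $ Inr a) y \<longleftrightarrow>
    solves_ode_on T (hamiltonian_field (\<lambda>x. dirac_tensor \<omega> \<Phi> (g x)) (\<lambda>x. H (g x))) y"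
  unfolding solves_ode_on_def using assms
  by (intro ball_cong refl) (subst reduced_field, auto)

end

end

theorem mainTheorem10:
  fixes U :: "(real^('m::finite + 'k::finite)) set"
    and \<omega> :: "real^('m + 'k) \<Rightarrow> real^('m + 'k)^('m + 'k)"
    and H :: "real^('m + 'k) \<Rightarrow> real"
    and \<Phi> :: "'m \<Rightarrow> real^('m + 'k) \<Rightarrow> real"
    and V :: "(real^'k) set"
    and f :: "real^'k \<Rightarrow> real^'m"
  assumes "open U"
    and "poisson_tensor_on U \<omega>"
    and "\<forall>z\<in>U. det (\<omega> z) \<noteq> 0"
    and "smooth_on U H"
    and "\<forall>\<alpha>. smooth_on U (\<Phi> \<alpha>)"
    and "\<forall>z\<in>U. rank ((\<chi> \<alpha> i. pd i (\<Phi> \<alpha>) z) :: real^('m + 'k)^'m) = CARD('m)"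
    and "\<forall>z\<in>U. det ((\<chi> \<alpha> \<beta>. pd (Inl \<beta>) (\<Phi> \<alpha>) z) :: real^'m^'m) \<noteq> 0"
    and "\<forall>z\<in>U. \<forall>\<alpha>. poisson_bracket \<omega> (\<Phi> \<alpha>) H z = 0"
    and "\<forall>z\<in>U. det (bracket_matrix \<omega> \<Phi> z) \<noteq> 0"
    and "open V"
    and "smooth_on V f"
    and "{z\<in>U. \<forall>\<alpha>. \<Phi> \<alpha> z = 0} = (\<lambda>y. glue (f y) y) ` V"
  shows "(\<forall>T y. open T \<and> is_interval T \<and> y ` T \<subseteq> V \<longrightarrow>
            (solves_ode_on T (hamiltonian_field \<omega> H) (\<lambda>t. glue (f (y t)) (y t)) \<longleftrightarrow>
             solves_ode_on T (\<lambda>x. \<chi> a. hamiltonian_field \<omega> H (glue (f x) x) $ Inr a) y) \<and>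
            (solves_ode_on T (\<lambda>x. \<chi> a. hamiltonian_field \<omega> H (glue (f x) x) $ Inr a) y \<longleftrightarrow>
             solves_ode_on T (hamiltonian_field (\<lambda>x. dirac_tensor \<omega> \<Phi> (glue (f x) x))
                                                (\<lambda>x. H (glue (f x) x))) y))
         \<and> poisson_tensor_on V (\<lambda>x. dirac_tensor \<omega> \<Phi> (glue (f x) x))"
proof -
  interpret constraint_surface U \<omega> \<Phi> V f
    by unfold_locales (rule assms assms(5)[rule_format] | erule assms(7,9)[rule_format])+
  have integral: "poisson_bracket \<omega> (\<Phi> \<alpha>) H z = 0" if "z \<in> U" for z \<alpha>
    by (rule assms(8)[rule_format, OF that])
  show ?thesis
    unfolding g_def[symmetric]
    by (intro conjI allI impI dirac_poisson lifted_solution_iff[OF assms(4) integral]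
        reduced_solution_iff[OF assms(4) integral]; elim conjE; assumption)
qed

end
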